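(* Let $f$ be a rational prime with $f\equiv\pm1\pmod 8$, let $(f)=\mathfrak{p}\bar{\mathfrak{p}}$ be the factorization of the ideal $(f)$ into prime ideals of $\mathbb{Z}[\sqrt2]$, and let $\mathfrak{u}\in\mathbb{Z}[\sqrt2]$ be a generator of $\mathfrak{p}$. Let $m\in\mathbb{Z}^+$, and let $X,Y\in\mathbb{Z}$ be defined by $$X+Y\sqrt{2}=\bigl((A_m+2B_m)+(A_m+B_m)\sqrt{2}\bigr)\mathfrak{u}^2,$$ where $A_0=1$, $A_1=3$, $B_0=0$, $B_1=2$, and $A_i=6A_{i-1}-A_{i-2}$, $B_i=6B_{i-1}-B_{i-2}$ for $i\ge 2$. Set $$a=\frac{X-f}{2},\qquad b=\frac{X+f}{2},\qquad c=Y.$$ Then $(a,b,c)$ is a primitive Pythagorean triple.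
   Context: A Pythagorean triple is a triple of integers $(a,b,c)\in\mathbb{Z}^3$ such that $a^2+b^2=c^2$. It is primitive if the only integer $d>0$ dividing all of $a$, $b$ and $c$ is $d=1$. The bar denotes conjugation $\overline{x+y\sqrt2}=x-y\sqrt2$ in $\mathbb{Z}[\sqrt2]$. The ring $\mathbb{Z}[\sqrt2]$ is a principal ideal domain, and a prime $f\equiv\pm1\pmod 8$ splits in it as $(f)=\mathfrak{p}\bar{\mathfrak{p}}$ with $\mathfrak{p},\bar{\mathfrak{p}}$ prime ideals. *)

theory Defs
  imports Complex_Main "HOL-Algebra.Ideal_Product" "HOL-Number_Theory.Cong"
    "HOL-Computational_Algebra.Primes"
begin

definition zsqrt2 :: "real ring" where
  "zsqrt2 = \<lparr>carrier = {of_int x + of_int y * sqrt 2 | x y :: int. True},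
             monoid.mult = (*), one = 1, zero = 0, add = (+)\<rparr>"

(* Image of I under x + y * sqrt 2 |-> x - y * sqrt 2; the integers x, y are
   determined by x + y * sqrt 2 because sqrt 2 is irrational. *)
definition conj_ideal :: "real set \<Rightarrow> real set" where
  "conj_ideal I = {of_int x - of_int y * sqrt 2 | x y :: int. of_int x + of_int y * sqrt 2 \<in> I}"

fun seqA :: "nat \<Rightarrow> int" where
  "seqA 0 = 1"
| "seqA (Suc 0) = 3"
| "seqA (Suc (Suc i)) = 6 * seqA (Suc i) - seqA i"

fun seqB :: "nat \<Rightarrow> int" where
  "seqB 0 = 0"
| "seqB (Suc 0) = 2"
| "seqB (Suc (Suc i)) = 6 * seqB (Suc i) - seqB i"

definition pythagorean_triple :: "int \<Rightarrow> int \<Rightarrow> int \<Rightarrow> bool" where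
  "pythagorean_triple a b c \<longleftrightarrow> a\<^sup>2 + b\<^sup>2 = c\<^sup>2"

definition primitive_pythagorean_triple :: "int \<Rightarrow> int \<Rightarrow> int \<Rightarrow> bool" where
  "primitive_pythagorean_triple a b c \<longleftrightarrow>
     pythagorean_triple a b c \<and> (\<forall>d>0. d dvd a \<and> d dvd b \<and> d dvd c \<longrightarrow> d = 1)"

end

theory Submission
  imports Defs
begin

text \<open>
  Everything is read off from the norm \<open>N(x + y\<surd>2) = x\<^sup>2 - 2y\<^sup>2\<close>.
  The Pell identity \<open>A\<^sub>m\<^sup>2 - 2B\<^sub>m\<^sup>2 = 1\<close> says that the multiplier
  \<open>w = (A\<^sub>m + 2B\<^sub>m) + (A\<^sub>m + B\<^sub>m)\<surd>2\<close> has norm \<open>-1\<close>.  Taking products of generators,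
  \<open>(f) = \<pp>\<pp>'\<close>, with \<open>\<pp>'\<close> the conjugate of \<open>\<pp>\<close>, becomes \<open>(f) = (N(u))\<close>, so that
  \<open>N(u) = \<plusminus>f\<close>.  Hence \<open>X\<^sup>2 - 2Y\<^sup>2 = N(w u\<^sup>2) = -f\<^sup>2\<close>.  This makes \<open>X\<close> odd like \<open>f\<close>, so \<open>a\<close>
  and \<open>b\<close> are integers, and it gives \<open>a\<^sup>2 + b\<^sup>2 = (X\<^sup>2 + f\<^sup>2)/2 = Y\<^sup>2\<close>.

  A common divisor of \<open>a\<close>, \<open>b\<close>, \<open>c\<close> divides \<open>b - a = f\<close> and \<open>a + b = X\<close>, so if it is not \<open>1\<close>
  it is \<open>f\<close>, and \<open>f\<close> divides \<open>w u\<^sup>2\<close>.  As \<open>w\<close> is a unit, \<open>f\<close> divides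
  \<open>u\<^sup>2 = (x\<^sup>2 + 2y\<^sup>2) + 2xy\<surd>2\<close>, where \<open>u = x + y\<surd>2\<close>.  Adding and subtracting
  \<open>x\<^sup>2 - 2y\<^sup>2 = \<plusminus>f\<close> shows that the odd prime \<open>f\<close> divides \<open>x\<close> and \<open>y\<close>,
  so \<open>f\<^sup>2\<close> would divide \<open>N(u) = \<plusminus>f\<close>, which is impossible.
\<close>

section \<open>Arithmetic in the ring\<close>

lemma int_square_eq_twice_square:
  fixes a b :: int
  assumes "a\<^sup>2 = 2 * b\<^sup>2"
  shows "b = 0"
proof (rule ccontr)
  assume b: "b \<noteq> 0"
  with assms have a: "a \<noteq> 0" by auto
  \<comment> \<open>The exponent of \<open>2\<close> is even on the left and odd on the right.\<close>
  have "multiplicity 2 (a\<^sup>2) = multiplicity 2 (2 * b\<^sup>2)" by (simp add: assms)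
  also have "2 * b\<^sup>2 = 2 ^ 1 * b ^ 2" by simp
  finally have "2 * multiplicity 2 a = 1 + 2 * multiplicity 2 b"
    using a b by (simp add: prime_elem_multiplicity_power_distrib prime_elem_multiplicity_mult_distrib
        power2_eq_square)
  then show False by presburger
qed

lemma sqrt2_coeffs_unique:
  fixes x y x' y' :: int
  assumes "of_int x + of_int y * sqrt 2 = of_int x' + of_int y' * sqrt 2"
  shows "x = x' \<and> y = y'"
proof -
  have "of_int (x' - x) = of_int (y - y') * sqrt 2"
    using assms by (simp add: algebra_simps)
  then have "(of_int (x' - x))\<^sup>2 = (of_int (y - y') * sqrt 2)\<^sup>2" by simp
  then have "real_of_int ((x' - x)\<^sup>2) = of_int (2 * (y - y')\<^sup>2)"
    by (simp add: power_mult_distrib)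
  then have "(x' - x)\<^sup>2 = 2 * (y - y')\<^sup>2" by (simp only: of_int_eq_iff)
  from int_square_eq_twice_square[OF this] assms show ?thesis by simp
qed

lemma carrier_zsqrt2I: "of_int x + of_int y * sqrt 2 \<in> carrier zsqrt2"
  unfolding zsqrt2_def by auto

lemma carrier_zsqrt2E:
  assumes "z \<in> carrier zsqrt2"
  obtains x y :: int where "z = of_int x + of_int y * sqrt 2"
  using assms unfolding zsqrt2_def by auto

lemma zsqrt2_simps [simp]:
  "z \<otimes>\<^bsub>zsqrt2\<^esub> z' = z * z'"
  "z \<oplus>\<^bsub>zsqrt2\<^esub> z' = z + z'"
  by (simp_all add: zsqrt2_def)

lemma zsqrt2_mult_coords:
  "(of_int p + of_int q * sqrt 2) * (of_int x + of_int y * sqrt 2) =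
     of_int (p * x + 2 * q * y) + of_int (p * y + q * x) * sqrt 2"
  by (simp add: algebra_simps)

lemma zsqrt2_mult_closed:
  assumes "z \<in> carrier zsqrt2" and "z' \<in> carrier zsqrt2"
  shows "z * z' \<in> carrier zsqrt2"
  using assms by (metis carrier_zsqrt2E carrier_zsqrt2I zsqrt2_mult_coords)

lemma zsqrt2_add_closed:
  assumes "z \<in> carrier zsqrt2" and "z' \<in> carrier zsqrt2"
  shows "z + z' \<in> carrier zsqrt2"
proof -
  obtain p q x y :: int
    where "z = of_int p + of_int q * sqrt 2" "z' = of_int x + of_int y * sqrt 2"
    using assms by (metis carrier_zsqrt2E)
  then have "z + z' = of_int (p + x) + of_int (q + y) * sqrt 2"
    by (simp add: algebra_simps)
  then show ?thesis by (metis carrier_zsqrt2I)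
qed

section \<open>Principal ideals and the norm\<close>

lemma PIdl_zsqrt2: "PIdl\<^bsub>zsqrt2\<^esub> z = {v * z | v. v \<in> carrier zsqrt2}"
  by (simp add: cgenideal_def)

lemma PIdl_self_zsqrt2: "z \<in> PIdl\<^bsub>zsqrt2\<^esub> z"
  using carrier_zsqrt2I[of 1 0] by (force simp: PIdl_zsqrt2)

lemma PIdl_of_int_dvd:
  fixes d n :: int
  assumes "of_int n \<in> PIdl\<^bsub>zsqrt2\<^esub> (of_int d)"
  shows "d dvd n"
proof -
  obtain x y :: int where "of_int n = (of_int x + of_int y * sqrt 2) * of_int d"
    using assms by (auto simp: PIdl_zsqrt2 elim!: carrier_zsqrt2E)
  then have "of_int n + of_int 0 * sqrt 2 = of_int (x * d) + of_int (y * d) * sqrt 2"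
    by (simp add: algebra_simps)
  then have "n = x * d" using sqrt2_coeffs_unique by blast
  then show ?thesis by simp
qed

text \<open>Conjugation is multiplicative, so it carries the multiples of a generator to the
  multiples of the conjugate generator.\<close>

lemma conj_ideal_PIdl:
  fixes x y :: int
  shows "conj_ideal (PIdl\<^bsub>zsqrt2\<^esub> (of_int x + of_int y * sqrt 2)) =
    PIdl\<^bsub>zsqrt2\<^esub> (of_int x - of_int y * sqrt 2)"
proof (intro equalityI subsetI)
  fix z assume "z \<in> conj_ideal (PIdl\<^bsub>zsqrt2\<^esub> (of_int x + of_int y * sqrt 2))"
  then obtain r s p q :: int where z: "z = of_int r - of_int s * sqrt 2"
    and "of_int r + of_int s * sqrt 2 =
      (of_int p + of_int q * sqrt 2) * (of_int x + of_int y * sqrt 2)"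
    by (auto simp: conj_ideal_def PIdl_zsqrt2 elim!: carrier_zsqrt2E)
  then have "r = p * x + 2 * q * y \<and> s = p * y + q * x"
    using sqrt2_coeffs_unique unfolding zsqrt2_mult_coords by blast
  then have "z = (of_int p + of_int (- q) * sqrt 2) * (of_int x - of_int y * sqrt 2)"
    unfolding z by (simp add: algebra_simps)
  then show "z \<in> PIdl\<^bsub>zsqrt2\<^esub> (of_int x - of_int y * sqrt 2)"
    unfolding PIdl_zsqrt2 using carrier_zsqrt2I by blast
next
  fix z assume "z \<in> PIdl\<^bsub>zsqrt2\<^esub> (of_int x - of_int y * sqrt 2)"
  then obtain p q :: int
    where z: "z = (of_int p + of_int q * sqrt 2) * (of_int x - of_int y * sqrt 2)"
    by (auto simp: PIdl_zsqrt2 elim!: carrier_zsqrt2E)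
  define r s where "r = p * x - 2 * q * y" and "s = p * y - q * x"
  have "of_int r + of_int s * sqrt 2 =
      (of_int p + of_int (- q) * sqrt 2) * (of_int x + of_int y * sqrt 2)"
    by (simp add: r_def s_def algebra_simps)
  then have "of_int r + of_int s * sqrt 2 \<in> PIdl\<^bsub>zsqrt2\<^esub> (of_int x + of_int y * sqrt 2)"
    unfolding PIdl_zsqrt2 using carrier_zsqrt2I by blast
  moreover have "z = of_int r - of_int s * sqrt 2"
    unfolding z by (simp add: r_def s_def algebra_simps)
  ultimately show "z \<in> conj_ideal (PIdl\<^bsub>zsqrt2\<^esub> (of_int x + of_int y * sqrt 2))"
    unfolding conj_ideal_def by blast
qed

lemma ideal_prod_PIdl:
  assumes "z \<in> carrier zsqrt2" and "z' \<in> carrier zsqrt2"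
  shows "ideal_prod zsqrt2 (PIdl\<^bsub>zsqrt2\<^esub> z) (PIdl\<^bsub>zsqrt2\<^esub> z') = PIdl\<^bsub>zsqrt2\<^esub> (z * z')"
proof (intro equalityI subsetI)
  fix t assume "t \<in> ideal_prod zsqrt2 (PIdl\<^bsub>zsqrt2\<^esub> z) (PIdl\<^bsub>zsqrt2\<^esub> z')"
  then show "t \<in> PIdl\<^bsub>zsqrt2\<^esub> (z * z')"
  proof (induction rule: ideal_prod.induct)
    case (prod i j)
    then obtain v v' where "v \<in> carrier zsqrt2" "v' \<in> carrier zsqrt2" "i = v * z" "j = v' * z'"
      by (auto simp: PIdl_zsqrt2)
    then have "i * j = (v * v') * (z * z')" "v * v' \<in> carrier zsqrt2"
      by (simp_all add: zsqrt2_mult_closed)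
    then show ?case unfolding PIdl_zsqrt2 by auto
  next
    case (sum s1 s2)
    then obtain v v' where "v \<in> carrier zsqrt2" "v' \<in> carrier zsqrt2"
      "s1 = v * (z * z')" "s2 = v' * (z * z')"
      by (auto simp: PIdl_zsqrt2)
    then have "s1 + s2 = (v + v') * (z * z')" "v + v' \<in> carrier zsqrt2"
      by (simp_all add: zsqrt2_add_closed distrib_right)
    then show ?case unfolding PIdl_zsqrt2 by auto
  qed
next
  fix t assume "t \<in> PIdl\<^bsub>zsqrt2\<^esub> (z * z')"
  then obtain v where "v \<in> carrier zsqrt2" and t: "t = (v * z) * z'"
    by (auto simp: PIdl_zsqrt2 mult.assoc)
  then have "v * z \<in> PIdl\<^bsub>zsqrt2\<^esub> z" by (auto simp: PIdl_zsqrt2)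
  from ideal_prod.prod[OF this PIdl_self_zsqrt2, of zsqrt2 z']
  show "t \<in> ideal_prod zsqrt2 (PIdl\<^bsub>zsqrt2\<^esub> z) (PIdl\<^bsub>zsqrt2\<^esub> z')"
    by (simp add: t)
qed

text \<open>The product of the two ideals is generated by the norm of the generator, and two
  integers generating the same ideal divide each other.\<close>

lemma abs_norm_generator:
  fixes f x y :: int
  defines "P \<equiv> PIdl\<^bsub>zsqrt2\<^esub> (of_int x + of_int y * sqrt 2)"
  assumes "PIdl\<^bsub>zsqrt2\<^esub> (of_int f) = ideal_prod zsqrt2 P (conj_ideal P)"
  shows "\<bar>x\<^sup>2 - 2 * y\<^sup>2\<bar> = \<bar>f\<bar>"
proof -
  have "of_int x - of_int y * sqrt 2 \<in> carrier zsqrt2"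
    using carrier_zsqrt2I[of x "- y"] by simp
  moreover have "(of_int x + of_int y * sqrt 2) * (of_int x - of_int y * sqrt 2) =
      of_int (x\<^sup>2 - 2 * y\<^sup>2)"
    by (simp add: algebra_simps power2_eq_square)
  ultimately have "ideal_prod zsqrt2 P (conj_ideal P) = PIdl\<^bsub>zsqrt2\<^esub> (of_int (x\<^sup>2 - 2 * y\<^sup>2))"
    unfolding P_def conj_ideal_PIdl by (subst ideal_prod_PIdl) (auto intro: carrier_zsqrt2I)
  with assms(2) have "PIdl\<^bsub>zsqrt2\<^esub> (of_int f) = PIdl\<^bsub>zsqrt2\<^esub> (of_int (x\<^sup>2 - 2 * y\<^sup>2))"
    by simp
  then show ?thesis
    by (metis PIdl_of_int_dvd PIdl_self_zsqrt2 zdvd_antisym_abs)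
qed

section \<open>The Pell unit\<close>

text \<open>The sequences are the coordinates \<open>A\<^sub>m + B\<^sub>m\<surd>2 = (3 + 2\<surd>2)\<^sup>m\<close>: their recurrence is the
  minimal equation \<open>\<epsilon>\<^sup>2 = 6\<epsilon> - 1\<close> of \<open>\<epsilon> = 3 + 2\<surd>2\<close>.  Multiplying by \<open>\<epsilon>\<close> gives the first-order
  form below, which preserves the norm because \<open>N(\<epsilon>) = 1\<close>.\<close>

lemma seqA_seqB_step:
  "seqA (Suc m) = 3 * seqA m + 4 * seqB m \<and> seqB (Suc m) = 2 * seqA m + 3 * seqB m"
proof (induction m)
  case 0
  show ?case by simp
next
  case (Suc m)
  then show ?case by auto
qed

lemma seqA_seqB_pell: "(seqA m)\<^sup>2 - 2 * (seqB m)\<^sup>2 = 1"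
proof (induction m)
  case 0
  show ?case by simp
next
  case (Suc m)
  have "(seqA (Suc m))\<^sup>2 - 2 * (seqB (Suc m))\<^sup>2 = (seqA m)\<^sup>2 - 2 * (seqB m)\<^sup>2"
    by (simp only: seqA_seqB_step power2_eq_square) (simp add: algebra_simps)
  with Suc show ?case by simp
qed

section \<open>Primitivity\<close>

text \<open>Here \<open>x\<^sup>2 + 2y\<^sup>2\<close> is the first coordinate of \<open>u\<^sup>2\<close> for \<open>u = x + y\<surd>2\<close>.  Its sum and
  difference with the norm of \<open>u\<close> are \<open>2x\<^sup>2\<close> and \<open>4y\<^sup>2\<close>, so divisibility by the odd prime
  \<open>f\<close> would pass to \<open>x\<close> and \<open>y\<close>, and \<open>f\<^sup>2\<close> would divide the norm \<open>\<plusminus>f\<close>.\<close>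

lemma prime_norm_not_dvd_square:
  fixes f x y :: int
  assumes "prime f" and "odd f" and "\<bar>x\<^sup>2 - 2 * y\<^sup>2\<bar> = f"
  shows "\<not> f dvd x\<^sup>2 + 2 * y\<^sup>2"
proof
  assume dvd: "f dvd x\<^sup>2 + 2 * y\<^sup>2"
  have norm: "f dvd x\<^sup>2 - 2 * y\<^sup>2" using assms(3) by (metis dvd_abs_iff dvd_refl)
  have not2: "\<not> f dvd 2"
    using prime_ge_2_int[OF assms(1)] \<open>odd f\<close> zdvd_imp_le[of f 2] by auto
  from dvd_add[OF dvd norm] have "f dvd 2 * x ^ 2" by simp
  with not2 \<open>prime f\<close> have "f dvd x ^ 2" by (simp add: prime_dvd_mult_iff)
  with \<open>prime f\<close> have x: "f dvd x" by (rule prime_dvd_power)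
  from dvd_diff[OF dvd norm] have "f dvd 2 * (2 * y ^ 2)" by simp
  with not2 \<open>prime f\<close> have "f dvd y ^ 2" by (simp only: prime_dvd_mult_iff) simp
  with \<open>prime f\<close> have y: "f dvd y" by (rule prime_dvd_power)
  have "f\<^sup>2 dvd x\<^sup>2 - 2 * y\<^sup>2"
    using x y by (intro dvd_diff dvd_mult dvd_power_same)
  then have "f * f dvd f * 1" using assms(3) by (metis dvd_abs_iff mult_1_right power2_eq_square)
  then have "f dvd 1" using \<open>prime f\<close> by (subst (asm) dvd_mult_cancel_left) auto
  with \<open>prime f\<close> show False using not_prime_unit by blast
qed

theorem theorem3p9:
  fixes f X Y :: int and P :: "real set" and u :: real and m :: nat
  assumes "prime f"
    and "[f = 1] (mod 8) \<or> [f = -1] (mod 8)"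
    and "primeideal P zsqrt2"
    and "primeideal (conj_ideal P) zsqrt2"
    and "PIdl\<^bsub>zsqrt2\<^esub> (of_int f) = ideal_prod zsqrt2 P (conj_ideal P)"
    and "u \<in> carrier zsqrt2"
    and "P = PIdl\<^bsub>zsqrt2\<^esub> u"
    and "m > 0"
    and "of_int X + of_int Y * sqrt 2 =
           (of_int (seqA m + 2 * seqB m) + of_int (seqA m + seqB m) * sqrt 2) * u\<^sup>2"
  shows "\<exists>a b c :: int.
           real_of_int a = (real_of_int X - real_of_int f) / 2 \<and>
           real_of_int b = (real_of_int X + real_of_int f) / 2 \<and>
           c = Y \<and>
           primitive_pythagorean_triple a b c"
proof -
  obtain x y :: int where u: "u = of_int x + of_int y * sqrt 2"
    using \<open>u \<in> carrier zsqrt2\<close> by (rule carrier_zsqrt2E)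
  have "f > 0" using \<open>prime f\<close> by (rule prime_gt_0_int)
  have norm_u: "\<bar>x\<^sup>2 - 2 * y\<^sup>2\<bar> = f"
    using abs_norm_generator[of f x y] assms(5,7) \<open>f > 0\<close> by (simp add: u)
  have "odd f"
  proof -
    have "[f = 1] (mod 2) \<or> [f = - 1] (mod 2)"
      using assms(2) by (auto intro: cong_dvd_modulus[where m = 8])
    then show ?thesis using cong_dvd_iff[of f 1 2] cong_dvd_iff[of f "- 1" 2] by auto
  qed

  define p q where "p = seqA m + 2 * seqB m" and "q = seqA m + seqB m"
  have norm_w: "p\<^sup>2 - 2 * q\<^sup>2 = - 1"
    using seqA_seqB_pell[of m] unfolding p_def q_def by (simp add: power2_eq_square algebra_simps)
  define s t where "s = x\<^sup>2 + 2 * y\<^sup>2" and "t = 2 * x * y"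
  have "u\<^sup>2 = of_int s + of_int t * sqrt 2"
    by (simp add: u s_def t_def power2_eq_square algebra_simps)
  with assms(9) have "of_int X + of_int Y * sqrt 2 =
      of_int (p * s + 2 * q * t) + of_int (p * t + q * s) * sqrt 2"
    by (simp only: flip: p_def q_def) (simp only: zsqrt2_mult_coords)
  then have X: "X = p * s + 2 * q * t" and Y: "Y = p * t + q * s"
    using sqrt2_coeffs_unique by blast+

  have "X\<^sup>2 - 2 * Y\<^sup>2 = (p\<^sup>2 - 2 * q\<^sup>2) * (s\<^sup>2 - 2 * t\<^sup>2)"
    unfolding X Y by (simp add: power2_eq_square algebra_simps)
  also have "s\<^sup>2 - 2 * t\<^sup>2 = (x\<^sup>2 - 2 * y\<^sup>2)\<^sup>2"
    unfolding s_def t_def by (simp add: power2_eq_square algebra_simps)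
  also have "(x\<^sup>2 - 2 * y\<^sup>2)\<^sup>2 = f\<^sup>2" by (metis norm_u power2_abs)
  finally have norm_X: "X\<^sup>2 + f\<^sup>2 = 2 * Y\<^sup>2" by (simp add: norm_w)
  then have "even (X\<^sup>2 + f\<^sup>2)" by simp
  with \<open>odd f\<close> have "odd X" by simp
  define a where "a = (X - f) div 2"
  have a: "X = 2 * a + f" using \<open>odd X\<close> \<open>odd f\<close> by (simp add: a_def)
  have "2 * (a\<^sup>2 + (a + f)\<^sup>2) = 2 * Y\<^sup>2"
    using norm_X unfolding a by (simp add: power2_eq_square algebra_simps)
  then have triple: "a\<^sup>2 + (a + f)\<^sup>2 = Y\<^sup>2" by simp

  have primitive: "d = 1" if "d > 0" "d dvd a" "d dvd a + f" "d dvd Y" for d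
  proof -
    have "d dvd f" using that by (simp add: dvd_add_right_iff)
    moreover have "d \<noteq> f"
    proof
      assume "d = f"
      then have "f dvd X" "f dvd Y" using that by (auto simp: a)
      \<comment> \<open>Multiplying by the conjugate of the unit \<open>p + q\<surd>2\<close> recovers \<open>-u\<^sup>2\<close>.\<close>
      have "s = (2 * q\<^sup>2 - p\<^sup>2) * s" using norm_w by simp
      also have "\<dots> = 2 * q * Y - p * X"
        unfolding X Y by (simp add: power2_eq_square algebra_simps)
      finally have "s = 2 * q * Y - p * X" .
      with \<open>f dvd X\<close> \<open>f dvd Y\<close> have "f dvd s" by simp
      with prime_norm_not_dvd_square[OF \<open>prime f\<close> \<open>odd f\<close> norm_u] show False
        by (simp add: s_def)
    qed
    ultimately show "d = 1" using \<open>prime f\<close> \<open>d > 0\<close> by (metis less_imp_le prime_int_iff)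
  qed

  show ?thesis
  proof (intro exI conjI)
    show "real_of_int a = (real_of_int X - real_of_int f) / 2" by (simp add: a)
    show "real_of_int (a + f) = (real_of_int X + real_of_int f) / 2" by (simp add: a)
    show "Y = Y" by (rule refl)
    show "primitive_pythagorean_triple a (a + f) Y"
      using triple primitive
      unfolding primitive_pythagorean_triple_def pythagorean_triple_def by blast
  qed
qed

end
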